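(* Let $(u_n)_{n \geq 1}$ be a sequence of positive integers with $u_n \to +\infty$ as $n \to +\infty$, and let $k$ be a positive integer. Then $$\sum_{n=1}^{+\infty} (-1)^{u_n - n} \frac{F_{u_{n+2k} - u_n}}{F_{u_n} F_{u_{n+2k}}} = \sum_{n=1}^{k} (-1)^{u_{2n-1}+1} \frac{F_{u_{2n} - u_{2n-1}}}{F_{u_{2n}} F_{u_{2n-1}}}.$$ In particular, if $u_n \equiv n \pmod 2$ for every positive integer $n$, then $$\sum_{n=1}^{+\infty} \frac{F_{u_{n+2k} - u_n}}{F_{u_n} F_{u_{n+2k}}} = \sum_{n=1}^{k} \frac{F_{u_{2n} - u_{2n-1}}}{F_{u_{2n}} F_{u_{2n-1}}}.$$
   Context: $(F_n)_{n \in \mathbb{Z}}$ is the Fibonacci sequence: $F_0 = 0$, $F_1 = 1$, $F_{n+2} = F_{n+1} + F_n$ for all $n \in \mathbb{Z}$ (so that $F_{-n} = (-1)^{n+1} F_n$). *)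

theory Defs
  imports Complex_Main "HOL-Number_Theory.Fib" "HOL-Number_Theory.Cong"
begin

definition fibz :: "int \<Rightarrow> int" where
  "fibz n = (if n \<ge> 0 then int (fib (nat n)) else (- 1) ^ (nat (- n) + 1) * int (fib (nat (- n))))"

text \<open>\<^const>\<open>fibz\<close> is the unique two-sided sequence satisfying the Fibonacci recurrence on all
  integers with initial values 0 and 1.\<close>

lemma fibz_0: "fibz 0 = 0"
  and fibz_1: "fibz 1 = 1"
  by (simp_all add: fibz_def)

lemma fibz_of_nat: "fibz (int n) = int (fib n)"
  by (simp add: fibz_def)

lemma fibz_uminus_of_nat: "fibz (- int n) = (- 1) ^ (n + 1) * int (fib n)"
  by (cases "n = 0") (simp_all add: fibz_def)

lemma fibz_rec: "fibz (n + 2) = fibz (n + 1) + fibz n"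
proof (cases "n \<ge> 0")
  case True
  then obtain m where m: "n = int m" using nonneg_int_cases by blast
  have "n + 2 = int (Suc (Suc m))" "n + 1 = int (Suc m)" using m by simp_all
  then show ?thesis
    unfolding m by (simp only: fibz_of_nat) simp
next
  case False
  show ?thesis
  proof (cases "n = - 1")
    case True
    then show ?thesis by (simp add: fibz_def)
  next
    case neq: False
    define m where "m = nat (- n - 2)"
    have e: "n = - int (Suc (Suc m))" "n + 1 = - int (Suc m)" "n + 2 = - int m"
      using False neq by (auto simp: m_def)
    show ?thesis
      unfolding e(2,3) unfolding e(1) fibz_uminus_of_nat by (simp add: algebra_simps)
  qed
qed

lemma fibz_unique:
  fixes f :: "int \<Rightarrow> int"
  assumes f0: "f 0 = 0" and f1: "f 1 = 1" and rec: "\<And>n. f (n + 2) = f (n + 1) + f n"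
  shows "f = fibz"
proof -
  have "f n = fibz n \<and> f (n + 1) = fibz (n + 1)" for n
  proof (induction n rule: int_induct[where k = 0])
    case base
    show ?case by (simp add: f0 f1 fibz_0 fibz_1)
  next
    case (step1 i)
    then show ?case using rec[of i] fibz_rec[of i] by (simp add: add.commute)
  next
    case (step2 i)
    then show ?case using rec[of "i - 1"] fibz_rec[of "i - 1"] by (simp add: add.commute)
  qed
  then show ?thesis by blast
qed

end

theory Submission imports Defs begin

text \<open>
  By d'Ocagne's identity, \<open>(-1)^b F(a - b) / (F a F b) = F(b+1)/F b - F(a+1)/F a\<close>. Hence the
  \<open>n\<close>-th term of the series is \<open>h n - h (n + 2k)\<close> with
  \<open>h n = (-1)^n (F(u n + 1)/F(u n) - \<phi>)\<close>. Subtracting the golden ratio \<open>\<phi>\<close> does not affect the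
  difference, because the shift \<open>2k\<close> is even, and it makes \<open>h\<close> tend to zero. The series
  therefore telescopes to \<open>h 1 + \<dots> + h (2k)\<close>, and pairing consecutive terms and applying the
  identity again gives the right-hand side.
\<close>

text \<open>Raising \<open>m\<close> by one adds the ordinary telescoping series with terms
  \<open>h (n + m) - h (n + Suc m)\<close>, whose sum is \<open>h m\<close> because the shifted
  sequence still tends to zero.\<close>

lemma sums_shift_difference:
  fixes h :: "nat \<Rightarrow> 'a::real_normed_vector"
  assumes "h \<longlonglongrightarrow> 0"
  shows "(\<lambda>n. h n - h (n + m)) sums (\<Sum>i<m. h i)"
proof (induction m)
  case 0
  show ?case by simp
next
  case (Suc m)
  have "(\<lambda>n. h (n + m)) \<longlonglongrightarrow> 0"
    using assms by (rule LIMSEQ_ignore_initial_segment)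
  from telescope_sums'[OF this] have "(\<lambda>n. h (n + m) - h (n + Suc m)) sums h m"
    by simp
  from sums_add[OF Suc.IH this] show ?case by simp
qed

text \<open>Since m - (n + 1) = (m - 1) - n, the induction hypothesis is applied at
  \<open>m - 1\<close>. Letting \<open>m\<close> range over all integers makes this always possible
  and covers m < n, which matters because \<open>u\<close> need not be monotone.\<close>

lemma fibz_dOcagne:
  "fibz (m - int n) * (- 1) ^ n = fibz m * int (fib (n + 1)) - fibz (m + 1) * int (fib n)"
proof (induction n arbitrary: m)
  case 0
  show ?case by simp
next
  case (Suc n)
  have "m - int (Suc n) = (m - 1) - int n" by simp
  moreover have "fibz (m + 1) = fibz m + fibz (m - 1)"
    using fibz_rec[of "m - 1"] by (simp add: add.commute)
  ultimately show ?case
    using Suc.IH[of "m - 1"] by (simp add: algebra_simps)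
qed

definition fib_quotient :: "nat \<Rightarrow> real" where
  "fib_quotient n = real (fib (n + 1)) / real (fib n)"

lemma fibz_quotient_difference:
  assumes "m > 0" "n > 0"
  shows "(- 1) ^ n * (real_of_int (fibz (int m - int n))
           / (real_of_int (fibz (int n)) * real_of_int (fibz (int m))))
         = fib_quotient n - fib_quotient m"
proof -
  have pos: "fib m > 0" "fib n > 0" using assms by (simp_all add: fib_neq_0_nat)
  have m1: "fibz (int m + 1) = int (fib (m + 1))"
    using fibz_of_nat[of "m + 1"] by (simp add: add.commute)
  have "real_of_int (fibz (int m - int n) * (- 1) ^ n)
      = real_of_int (fibz (int m) * int (fib (n + 1)) - fibz (int m + 1) * int (fib n))"
    by (simp only: fibz_dOcagne)
  then have "real_of_int (fibz (int m - int n)) * (- 1) ^ n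
      = real (fib m) * real (fib (n + 1)) - real (fib (m + 1)) * real (fib n)"
    by (simp only: m1 fibz_of_nat) simp
  then show ?thesis
    using pos unfolding fib_quotient_def fibz_of_nat
    by (simp add: field_simps del: fib.simps)
qed

text \<open>By Binet's asymptotics the ratio \<open>a n\<close> of F n to \<phi>^n / sqrt 5 tends to
  1, and F(n+1) / F n is \<phi> times a quotient of consecutive values of \<open>a\<close>.\<close>

lemma fib_quotient_tendsto: "fib_quotient \<longlonglongrightarrow> (1 + sqrt 5) / 2"
proof -
  define \<phi> :: real where "\<phi> = (1 + sqrt 5) / 2"
  define a where "a = (\<lambda>n. real (fib n) / (\<phi> ^ n / sqrt 5))"
  have \<phi>: "\<phi> > 0" by (simp add: \<phi>_def add_pos_pos)
  have a: "a \<longlonglongrightarrow> 1"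
    using fib_asymptotics unfolding a_def \<phi>_def .
  have "(\<lambda>n. \<phi> * (a (Suc n) / a n)) \<longlonglongrightarrow> \<phi> * (1 / 1)"
    by (intro tendsto_intros LIMSEQ_Suc a) simp
  \<comment> \<open>This holds at n = 0 too: both sides divide by zero and are therefore 0.\<close>
  moreover have "(\<lambda>n. \<phi> * (a (Suc n) / a n)) = fib_quotient"
    using \<phi> by (simp add: fun_eq_iff a_def fib_quotient_def)
  ultimately show ?thesis by (simp add: \<phi>_def)
qed

lemma sum_consecutive_pairs:
  fixes f :: "nat \<Rightarrow> 'a::comm_monoid_add"
  shows "(\<Sum>i<2 * k. f (i + 1)) = (\<Sum>n = 1..k. f (2 * n - 1) + f (2 * n))"
  by (induction k) (simp_all add: add.assoc)

text \<open>A sign is its own inverse. The factor with exponent \<open>m\<close> comes last so that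
  it ends up next to \<open>t\<close>, ready for d'Ocagne's identity.\<close>

lemma minus_one_powi_diff:
  "(- 1 :: real) powi (int m - int n) = (- 1) ^ n * (- 1) ^ m"
  by (simp add: power_int_diff power_int_of_nat field_simps power_add flip: power_mult_distrib)

theorem theorem2p5:
  fixes u :: "nat \<Rightarrow> nat" and k :: nat
  assumes u_pos: "\<And>n. n \<ge> 1 \<Longrightarrow> u n > 0"
    and u_lim: "filterlim u at_top at_top"
    and k_pos: "k > 0"
  shows "(\<lambda>n. (- 1 :: real) powi (int (u (n + 1)) - int (n + 1))
              * (real_of_int (fibz (int (u (n + 1 + 2 * k)) - int (u (n + 1))))
                 / (real_of_int (fibz (int (u (n + 1)))) * real_of_int (fibz (int (u (n + 1 + 2 * k)))))))
          sums (\<Sum>n = 1..k. (- 1 :: real) ^ (u (2 * n - 1) + 1)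
              * (real_of_int (fibz (int (u (2 * n)) - int (u (2 * n - 1))))
                 / (real_of_int (fibz (int (u (2 * n)))) * real_of_int (fibz (int (u (2 * n - 1)))))))
       \<and> ((\<forall>n\<ge>1. [u n = n] (mod 2)) \<longrightarrow>
          (\<lambda>n. real_of_int (fibz (int (u (n + 1 + 2 * k)) - int (u (n + 1))))
                 / (real_of_int (fibz (int (u (n + 1)))) * real_of_int (fibz (int (u (n + 1 + 2 * k))))))
          sums (\<Sum>n = 1..k. real_of_int (fibz (int (u (2 * n)) - int (u (2 * n - 1))))
                 / (real_of_int (fibz (int (u (2 * n)))) * real_of_int (fibz (int (u (2 * n - 1)))))))"
proof -
  define \<phi> :: real where "\<phi> = (1 + sqrt 5) / 2"
  define r where "r n = fib_quotient (u n)" for n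
  define h where "h n = (- 1) ^ n * (r n - \<phi>)" for n
  define t where "t a b = real_of_int (fibz (int (u b) - int (u a)))
      / (real_of_int (fibz (int (u a))) * real_of_int (fibz (int (u b))))" for a b
  have t: "(- 1) ^ u a * t a b = r a - r b" if "a \<ge> 1" "b \<ge> 1" for a b
    unfolding t_def r_def using that by (intro fibz_quotient_difference u_pos)
  have "r \<longlonglongrightarrow> \<phi>"
    unfolding r_def \<phi>_def by (rule filterlim_compose[OF fib_quotient_tendsto u_lim])
  then have "(\<lambda>n. r n - \<phi>) \<longlonglongrightarrow> 0"
    by (simp add: LIM_zero)
  then have "h \<longlonglongrightarrow> 0"
    \<comment> \<open>Passing to absolute values removes the alternating sign.\<close>
    unfolding tendsto_norm_zero_iff[symmetric, of h]
    by (simp add: h_def abs_mult power_abs tendsto_rabs_zero_iff)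
  \<comment> \<open>\<open>sums\<close> counts from 0 while the series starts at index 1.\<close>
  then have "(\<lambda>n. h (n + 1)) \<longlonglongrightarrow> 0"
    by (rule LIMSEQ_ignore_initial_segment)
  from sums_shift_difference[OF this, of "2 * k"]
  have "(\<lambda>n. h (n + 1) - h (n + 2 * k + 1)) sums (\<Sum>n = 1..k. h (2 * n - 1) + h (2 * n))"
    by (simp only: sum_consecutive_pairs)
  moreover have "h (n + 1) - h (n + 2 * k + 1)
      = (- 1) powi (int (u (n + 1)) - int (n + 1)) * t (n + 1) (n + 1 + 2 * k)" for n
  proof -
    have "(- 1) powi (int (u (n + 1)) - int (n + 1)) * t (n + 1) (n + 1 + 2 * k)
        = (- 1) ^ (n + 1) * (r (n + 1) - r (n + 1 + 2 * k))"
      unfolding minus_one_powi_diff mult.assoc by (subst t) simp_all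
    moreover have "(- 1 :: real) ^ (n + 2 * k + 1) = (- 1) ^ (n + 1)"
      by (simp add: power_add)
    ultimately show ?thesis
      unfolding h_def by (simp only: ac_simps) (simp add: algebra_simps)
  qed
  moreover have "h (2 * n - 1) + h (2 * n) = (- 1) ^ (u (2 * n - 1) + 1) * t (2 * n - 1) (2 * n)"
    if "n \<in> {1..k}" for n
  proof -
    \<comment> \<open>Now 2n - 1 becomes 2j + 1, so \<open>h\<close> has sign -1 there and +1 at 2n.
      The pair equals r(2n) - r(2n-1), the negative of the identity \<open>t\<close>; hence the
      extra 1 in the exponent.\<close>
    from that obtain j where "n = Suc j" by (cases n) auto
    then show ?thesis
      using t[of "2 * n - 1" "2 * n"] by (simp add: h_def)
  qed
  ultimately have main: "(\<lambda>n. (- 1) powi (int (u (n + 1)) - int (n + 1)) * t (n + 1) (n + 1 + 2 * k))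
      sums (\<Sum>n = 1..k. (- 1) ^ (u (2 * n - 1) + 1) * t (2 * n - 1) (2 * n))"
    by (simp only: cong: sum.cong)
  have parity: "(\<lambda>n. t (n + 1) (n + 1 + 2 * k)) sums (\<Sum>n = 1..k. t (2 * n - 1) (2 * n))"
    if cong: "\<forall>n\<ge>1. [u n = n] (mod 2)"
  proof -
    have ev: "even (u n) \<longleftrightarrow> even n" if "n \<ge> 1" for n
      using cong that by (simp add: cong_def even_iff_mod_2_eq_zero)
    have "(- 1 :: real) powi (int (u (n + 1)) - int (n + 1)) = 1" for n
      unfolding minus_one_powi_diff using ev[of "n + 1"] by (simp flip: power_add)
    moreover have "(- 1 :: real) ^ (u (2 * n - 1) + 1) = 1" if "n \<in> {1..k}" for n
    proof -
      have "2 * n - 1 \<ge> 1" using that by auto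
      from ev[OF this] have "odd (u (2 * n - 1))" using that by simp
      then show ?thesis by simp
    qed
    ultimately show ?thesis
      using main by (simp only: mult_1_left cong: sum.cong)
  qed
  show ?thesis
    \<comment> \<open>The finite sums in the goal have the two denominator factors in the opposite
      order to \<open>t\<close>.\<close>
    using main parity unfolding t_def by (simp only: mult.commute) blast
qed

end
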